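(* Let $a,b,c>0$, $\Delta t>0$, $\mathbf{A}=\begin{pmatrix}-ac & bc\\ a&-b\end{pmatrix}$, let $\mathbf{y}^*>\mathbf{0}$ be a steady state of $\mathbf{y}'=\mathbf{A}\mathbf{y}$ (i.e. $\mathbf{y}^*\in\ker(\mathbf{A})\cap\mathbb{R}^2_{>0}$), and let $\sigma_1,\sigma_2,r\in\mathcal{C}^2(\mathbb{R}^2_{>0},\mathbb{R}_{>0})$, $\boldsymbol{\sigma}=(\sigma_1,\sigma_2)^{\mathsf T}$. Let $\mathcal{D}$ be a sufficiently small neighborhood of $\mathbf{y}^*$ and suppose that $\boldsymbol{\sigma}(\mathbf{v})=\mathbf{v}$ for all $\mathbf{v}\in C=\ker(\mathbf{A})\cap\mathcal{D}$. Then the map $\mathbf{g}$ generating the iterates of the gBBKS1 scheme (defined in the context) satisfies $\mathbf{g}(\mathbf{v})=\mathbf{v}$ for all $\mathbf{v}\in C$, and the following hold. a) $\mathbf{g}\in\mathcal{C}^1(\mathcal{D})$ and $\mathbf{D}\mathbf{g}(\mathbf{y}^* )=\mathbf{I}+\Delta t\mathbf{A}$. b) The first derivatives of $\mathbf{g}$ are bounded and Lipschitz continuous on $\mathcal{D}$.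
   Context: The first order gBBKS (gBBKS1) scheme applied to $\mathbf{y}'=\mathbf{A}\mathbf{y}$ is implicitly given, for $\mathbf{y}^n\in\mathbb{R}^2_{>0}$, by $$y_i^{n+1}=y_i^n+\Delta t(\mathbf{A}\mathbf{y}^n)_i\Bigl(\prod_{m\in M^n}\frac{y_m^{n+1}}{\sigma_m(\mathbf{y}^n)}\Bigr)^{r(\mathbf{y}^n)},\quad i=1,2,\qquad M^n=\{m\in\{1,2\}\mid(\mathbf{A}\mathbf{y}^n)_m<0\},$$ with the empty product equal to $1$. It is known that for each $\mathbf{y}^n\in\mathbb{R}^2_{>0}$ this has a unique solution $\mathbf{y}^{n+1}\in\mathbb{R}^2_{>0}$; the resulting map is $\mathbf{g}\colon\mathbb{R}^2_{>0}\to\mathbb{R}^2_{>0}$, $\mathbf{y}^{n+1}=\mathbf{g}(\mathbf{y}^n)$. $\mathbf{D}\mathbf{g}$ denotes the Jacobian of $\mathbf g$. *)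

theory Defs
  imports "HOL-Analysis.Analysis"
begin

definition pos_orthant :: "(real ^ 2) set" where
  "pos_orthant = {y. \<forall>i. 0 < y $ i}"

text \<open>
  The derivatives in the next two definitions are full Frechet derivatives at the points
  of \<open>S\<close> (not derivatives within \<open>S\<close>), so for a set \<open>S\<close> that is not open they also refer to
  values of \<open>f\<close> near \<open>S\<close>.
\<close>

definition C1_on :: "('a::real_normed_vector \<Rightarrow> 'b::real_normed_vector) \<Rightarrow> 'a set \<Rightarrow> bool" where
  "C1_on f S \<longleftrightarrow> (\<exists>f' :: 'a \<Rightarrow> 'a \<Rightarrow>\<^sub>L 'b.
     (\<forall>x\<in>S. (f has_derivative blinfun_apply (f' x)) (at x)) \<and> continuous_on S f')"

definition C2_on :: "('a::real_normed_vector \<Rightarrow> 'b::real_normed_vector) \<Rightarrow> 'a set \<Rightarrow> bool" where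
  "C2_on f S \<longleftrightarrow> (\<exists>f' :: 'a \<Rightarrow> 'a \<Rightarrow>\<^sub>L 'b.
     (\<forall>x\<in>S. (f has_derivative blinfun_apply (f' x)) (at x)) \<and> C1_on f' S)"

definition system_matrix :: "real \<Rightarrow> real \<Rightarrow> real \<Rightarrow> real ^ 2 ^ 2" where
  "system_matrix a b c = vector [vector [- (a * c), b * c], vector [a, - b]]"

text \<open>
  The arguments \<open>y\<close> and \<open>z\<close> are the old and the new iterate. The exponent is real, so the
  equation has its intended meaning when all entries of \<open>z\<close> and \<open>\<sigma> y\<close> are positive.
\<close>

definition gBBKS1_step ::
  "real ^ 2 ^ 2 \<Rightarrow> real \<Rightarrow> (real ^ 2 \<Rightarrow> real ^ 2) \<Rightarrow> (real ^ 2 \<Rightarrow> real) \<Rightarrow> real ^ 2 \<Rightarrow> real ^ 2 \<Rightarrow> bool"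
where
  "gBBKS1_step A dt \<sigma> r y z \<longleftrightarrow>
     (\<forall>i. z $ i = y $ i + dt * (A *v y) $ i *
        (\<Prod>m\<in>{m. (A *v y) $ m < 0}. z $ m / \<sigma> y $ m) powr r y)"

text \<open>
  The map is only meaningful on the positive orthant, where the positive solution of the
  implicit equation exists and is unique.
\<close>

definition gBBKS1_map ::
  "real ^ 2 ^ 2 \<Rightarrow> real \<Rightarrow> (real ^ 2 \<Rightarrow> real ^ 2) \<Rightarrow> (real ^ 2 \<Rightarrow> real) \<Rightarrow> real ^ 2 \<Rightarrow> real ^ 2"
where
  "gBBKS1_map A dt \<sigma> r y = (THE z. z \<in> pos_orthant \<and> gBBKS1_step A dt \<sigma> r y z)"

end

theory Submission
  imports Defs
begin

text \<open>
  Write \<open>A y = w(y) q\<close> with a linear functional \<open>w\<close> and \<open>q = (-c, 1)\<close>. On the half-plane where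
  component \<open>m\<close> of \<open>A y\<close> is negative (\<open>m = 1\<close> for \<open>w > 0\<close>, \<open>m = 2\<close> for \<open>w < 0\<close>), the scheme reduces to
  one scalar equation for the new value of that component. Its left-hand side is increasing, so the
  solution is unique; near \<open>y\<^sup>*\<close> it extends across the line \<open>w = 0\<close> by the implicit function
  theorem, for functions whose derivative is locally Lipschitz. Hence \<open>g\<close> agrees on each closed
  half-plane with some \<open>P(y) = y + dt \<phi>(y) A y\<close> that has a locally Lipschitz derivative. On the line
  \<open>w = 0\<close> both factors \<open>\<phi>\<close> equal 1, because \<open>\<sigma>\<close> is the identity there, so both branches have the derivative
  \<open>I + dt A\<close>, and they glue to a function with Lipschitz derivative.
\<close>

section \<open>Functions with locally Lipschitz derivative\<close>

definition lip_at :: "('a::metric_space \<Rightarrow> 'b::metric_space) \<Rightarrow> 'a \<Rightarrow> bool" where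
  "lip_at f x \<longleftrightarrow> (\<exists>e>0. \<exists>L. L-lipschitz_on (ball x e) f)"

text \<open>This class lies between C^1 and C^2. It is preserved by gluing along a line, across
  which second derivatives may jump. The form as a germ at \<open>x\<close>, without a fixed open
  set, lets filter reasoning shrink the neighbourhoods.\<close>

definition C11_at :: "('a::real_normed_vector \<Rightarrow> 'b::real_normed_vector) \<Rightarrow> 'a \<Rightarrow> bool" where
  "C11_at f x \<longleftrightarrow> (\<exists>f' :: 'a \<Rightarrow> 'a \<Rightarrow>\<^sub>L 'b.
     (\<forall>\<^sub>F y in nhds x. (f has_derivative blinfun_apply (f' y)) (at y)) \<and> lip_at f' x)"

lemma lip_atI:
  assumes "e > 0" "L-lipschitz_on (ball x e) f"
  shows "lip_at f x"
  using assms unfolding lip_at_def by blast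

lemma lip_atE:
  assumes "lip_at f x"
  obtains e L where "e > 0" "L \<ge> 0"
    "\<And>y z. dist y x < e \<Longrightarrow> dist z x < e \<Longrightarrow> dist (f y) (f z) \<le> L * dist y z"
  using assms unfolding lip_at_def
  by (metis dist_commute lipschitz_on_def mem_ball)

lemma lip_atI':
  assumes "e > 0"
    and "\<And>y z. dist y x < e \<Longrightarrow> dist z x < e \<Longrightarrow> dist (f y) (f z) \<le> L * dist y z"
  shows "lip_at f x"
proof (rule lip_atI[OF assms(1)])
  \<comment> \<open>\<open>lipschitz_on\<close> demands a nonnegative constant, and \<open>L\<close>
    may have any sign here.\<close>
  show "\<bar>L\<bar>-lipschitz_on (ball x e) f"
  proof (rule lipschitz_onI)
    fix y z assume "y \<in> ball x e" "z \<in> ball x e"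
    then have "dist (f y) (f z) \<le> L * dist y z"
      using assms(2) by (simp add: dist_commute)
    also have "\<dots> \<le> \<bar>L\<bar> * dist y z"
      by (intro mult_right_mono) auto
    finally show "dist (f y) (f z) \<le> \<bar>L\<bar> * dist y z" .
  qed simp
qed

lemma lip_at_const: "lip_at (\<lambda>_. c) x"
  by (rule lip_atI'[of 1 _ _ 0]) auto

lemma lip_at_imp_isCont:
  assumes "lip_at f x"
  shows "isCont f x"
proof -
  from assms obtain e L where "e > 0" and L: "L-lipschitz_on (ball x e) f"
    unfolding lip_at_def by blast
  then show ?thesis
    using lipschitz_on_continuous_on[OF L] by (simp add: continuous_on_eq_continuous_at)
qed

lemma isCont_imp_filterlim_nhds:
  assumes "isCont f x"
  shows "filterlim f (nhds (f x)) (nhds x)"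
  using assms by (simp add: isCont_def tendsto_at_iff_tendsto_nhds)

lemma isCont_imp_bounded_nhds:
  fixes f :: "'a::t2_space \<Rightarrow> 'b::real_normed_vector"
  assumes "isCont f x"
  shows "\<forall>\<^sub>F y in nhds x. norm (f y) \<le> norm (f x) + 1"
proof -
  have "\<forall>\<^sub>F y in nhds x. dist (f y) (f x) < 1"
    using assms by (simp add: isCont_def tendsto_iff eventually_nhds_conv_at)
  then show ?thesis
  proof eventually_elim
    case (elim y)
    then show ?case
      using norm_triangle_ineq2[of "f y" "f x"] by (simp add: dist_norm)
  qed
qed

lemma lip_at_imp_bounded:
  fixes f :: "'a::metric_space \<Rightarrow> 'b::real_normed_vector"
  assumes "lip_at f x"
  obtains B where "\<forall>\<^sub>F y in nhds x. norm (f y) \<le> B"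
  using isCont_imp_bounded_nhds[OF lip_at_imp_isCont[OF assms]] by (rule that)

lemma lip_at_compose:
  assumes g: "lip_at g x" and f: "lip_at f (g x)"
  shows "lip_at (\<lambda>y. f (g y)) x"
proof -
  from g obtain d K where d: "d > 0" "K \<ge> 0"
    "\<And>y z. dist y x < d \<Longrightarrow> dist z x < d \<Longrightarrow> dist (g y) (g z) \<le> K * dist y z"
    by (rule lip_atE) blast
  from f obtain e L where e: "e > 0" "L \<ge> 0"
    "\<And>y z. dist y (g x) < e \<Longrightarrow> dist z (g x) < e \<Longrightarrow> dist (f y) (f z) \<le> L * dist y z"
    by (rule lip_atE) blast
  \<comment> \<open>The summand 1 keeps the radius \<open>e / (K + 1)\<close> positive even when
    \<open>K = 0\<close>.\<close>
  have near: "dist (g y) (g x) < e" if "dist y x < min d (e / (K + 1))" for y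
  proof -
    have "dist (g y) (g x) \<le> K * dist y x"
      using d that by simp
    also have "\<dots> \<le> (K + 1) * dist y x"
      by (intro mult_right_mono) auto
    also have "\<dots> < e"
      using that d(2) by (simp add: field_simps)
    finally show ?thesis .
  qed
  show ?thesis
  proof (rule lip_atI'[of "min d (e / (K + 1))" _ _ "L * K"])
    fix y z assume yz: "dist y x < min d (e / (K + 1))" "dist z x < min d (e / (K + 1))"
    have "dist (f (g y)) (f (g z)) \<le> L * dist (g y) (g z)"
      using e near yz by blast
    also have "\<dots> \<le> L * (K * dist y z)"
      using d yz e by (intro mult_left_mono) auto
    finally show "dist (f (g y)) (f (g z)) \<le> L * K * dist y z" by simp
  qed (use d e in auto)
qed

text \<open>Stated for any bounded bilinear product, to serve both composition of operators in the
  chain rule and scaling in the product rule. Both factors are bounded near \<open>x\<close>, so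
  telescoping the difference gives the estimate.\<close>

lemma (in bounded_bilinear) lip_at:
  assumes "lip_at f x" "lip_at g x"
  shows "lip_at (\<lambda>y. prod (f y) (g y)) x"
proof -
  from assms(1) obtain B where B: "\<forall>\<^sub>F y in nhds x. norm (f y) \<le> B"
    by (rule lip_at_imp_bounded)
  from assms(2) obtain C where C: "\<forall>\<^sub>F y in nhds x. norm (g y) \<le> C"
    by (rule lip_at_imp_bounded)
  from assms(1) obtain d K where d: "d > 0" "K \<ge> 0"
    "\<And>y z. dist y x < d \<Longrightarrow> dist z x < d \<Longrightarrow> dist (f y) (f z) \<le> K * dist y z"
    by (rule lip_atE) blast
  from assms(2) obtain e L where e: "e > 0" "L \<ge> 0"
    "\<And>y z. dist y x < e \<Longrightarrow> dist z x < e \<Longrightarrow> dist (g y) (g z) \<le> L * dist y z"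
    by (rule lip_atE) blast
  from B C obtain u where u: "u > 0"
    "\<And>y. dist y x < u \<Longrightarrow> norm (f y) \<le> B \<and> norm (g y) \<le> C"
    unfolding eventually_nhds_metric by (metis min_less_iff_conj)
  obtain M where M: "\<And>a b. norm (prod a b) \<le> norm a * norm b * M" "M \<ge> 0"
    using nonneg_bounded by blast
  show ?thesis
  proof (rule lip_atI'[of "min u (min d e)" _ _ "(B * L + C * K) * M"])
    fix y z assume yz: "dist y x < min u (min d e)" "dist z x < min u (min d e)"
    have "prod (f y) (g y) - prod (f z) (g z) = prod (f y) (g y - g z) + prod (f y - f z) (g z)"
      by (simp add: diff_left diff_right)
    then have "dist (prod (f y) (g y)) (prod (f z) (g z))
        \<le> norm (prod (f y) (g y - g z)) + norm (prod (f y - f z) (g z))"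
      by (simp add: dist_norm norm_triangle_ineq)
    also have "\<dots> \<le> norm (f y) * norm (g y - g z) * M + norm (f y - f z) * norm (g z) * M"
      by (intro add_mono M)
    also have "\<dots> \<le> B * (L * dist y z) * M + (K * dist y z) * C * M"
      using u(2)[of y] u(2)[of z] yz d(3)[of y z] e(3)[of y z] M(2) d(2)
      by (intro add_mono mult_right_mono mult_mono) (auto simp: dist_norm intro: order_trans[OF norm_ge_zero])
    finally show "dist (prod (f y) (g y)) (prod (f z) (g z)) \<le> (B * L + C * K) * M * dist y z"
      by (simp add: algebra_simps)
  qed (use u d e in auto)
qed

lemma lip_at_add:
  fixes f g :: "'a::metric_space \<Rightarrow> 'b::real_normed_vector"
  assumes "lip_at f x" "lip_at g x"
  shows "lip_at (\<lambda>y. f y + g y) x"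
proof -
  from assms(1) obtain d K where "d > 0" "K-lipschitz_on (ball x d) f"
    unfolding lip_at_def by blast
  moreover from assms(2) obtain e L where "e > 0" "L-lipschitz_on (ball x e) g"
    unfolding lip_at_def by blast
  ultimately show ?thesis
    by (intro lip_atI[of "min d e" "K + L"] lipschitz_on_add) (auto elim: lipschitz_on_subset)
qed

section \<open>Lipschitz bounds from derivatives\<close>

text \<open>Mean value inequality on a ball, which is convex.\<close>

lemma has_derivative_bounded_imp_lip_at:
  fixes f :: "'a::real_normed_vector \<Rightarrow> 'b::real_normed_vector"
  assumes "\<forall>\<^sub>F y in nhds x. (f has_derivative blinfun_apply (f' y)) (at y)"
    and "\<forall>\<^sub>F y in nhds x. norm (f' y) \<le> B"
  shows "lip_at f x"
proof -
  from assms obtain e where e: "e > 0"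
    "\<And>y. dist y x < e \<Longrightarrow> (f has_derivative blinfun_apply (f' y)) (at y) \<and> norm (f' y) \<le> B"
    unfolding eventually_nhds_metric by (metis min_less_iff_conj)
  show ?thesis
  proof (rule lip_atI'[OF e(1)])
    fix y z assume yz: "dist y x < e" "dist z x < e"
    have "norm (f y - f z) \<le> B * norm (y - z)"
    proof (rule differentiable_bound[where S = "ball x e" and f' = "\<lambda>y. blinfun_apply (f' y)"])
      show "(f has_derivative blinfun_apply (f' u)) (at u within ball x e)"
        and "onorm (blinfun_apply (f' u)) \<le> B" if "u \<in> ball x e" for u
        using e(2)[of u] that
        by (auto simp: dist_commute norm_blinfun.rep_eq intro: has_derivative_at_withinI)
    qed (use yz in \<open>auto simp: dist_commute\<close>)
    then show "dist (f y) (f z) \<le> B * dist y z"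
      by (simp add: dist_norm)
  qed
qed

text \<open>A continuous derivative is locally bounded, so the mean value inequality
  applies.\<close>

lemma C1_on_imp_lip_at:
  assumes "C1_on f S" "open S" "x \<in> S"
  shows "lip_at f x"
proof -
  from assms(1) obtain f' where f': "\<And>y. y \<in> S \<Longrightarrow> (f has_derivative blinfun_apply (f' y)) (at y)"
      "continuous_on S f'"
    unfolding C1_on_def by blast
  have "isCont f' x"
    using f'(2) assms by (simp add: continuous_on_eq_continuous_at)
  moreover have "\<forall>\<^sub>F y in nhds x. (f has_derivative blinfun_apply (f' y)) (at y)"
    using eventually_nhds_in_open[OF assms(2,3)] by eventually_elim (rule f'(1))
  ultimately show ?thesis
    by (rule has_derivative_bounded_imp_lip_at[OF _ isCont_imp_bounded_nhds, rotated])
qed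

text \<open>The derivative is itself C^1, hence locally Lipschitz. This is how the smoothness of
  \<open>\<sigma>\<close> and \<open>r\<close> enters.\<close>

lemma C2_on_imp_C11_at:
  assumes "C2_on f S" "open S" "x \<in> S"
  shows "C11_at f x"
proof -
  from assms(1) obtain f' where f': "\<And>y. y \<in> S \<Longrightarrow> (f has_derivative blinfun_apply (f' y)) (at y)"
      "C1_on f' S"
    unfolding C2_on_def by blast
  have "\<forall>\<^sub>F y in nhds x. (f has_derivative blinfun_apply (f' y)) (at y)"
    using eventually_nhds_in_open[OF assms(2,3)] by eventually_elim (rule f'(1))
  then show ?thesis
    using C1_on_imp_lip_at[OF f'(2) assms(2,3)] unfolding C11_at_def by (intro exI[of _ f'] conjI)
qed

section \<open>Calculus rules for locally Lipschitz derivatives\<close>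

lemma C11_atE:
  assumes "C11_at f x"
  obtains f' where "\<forall>\<^sub>F y in nhds x. (f has_derivative blinfun_apply (f' y)) (at y)" "lip_at f' x"
  using assms unfolding C11_at_def by blast

lemma C11_at_imp_lip_at:
  assumes "C11_at f x"
  shows "lip_at f x"
proof -
  from assms obtain f' where f': "\<forall>\<^sub>F y in nhds x. (f has_derivative blinfun_apply (f' y)) (at y)" "lip_at f' x"
    by (rule C11_atE)
  show ?thesis
    by (rule has_derivative_bounded_imp_lip_at[OF f'(1)
          isCont_imp_bounded_nhds[OF lip_at_imp_isCont[OF f'(2)]]])
qed

lemma C11_at_imp_isCont:
  assumes "C11_at f x"
  shows "isCont f x"
  by (rule lip_at_imp_isCont[OF C11_at_imp_lip_at[OF assms]])

lemma C11_at_const: "C11_at (\<lambda>_. c) x"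
  unfolding C11_at_def
  by (rule exI[of _ "\<lambda>_. 0"]) (auto intro!: lip_at_const always_eventually simp: zero_blinfun.rep_eq)

lemma C11_at_bounded_linear:
  assumes "bounded_linear f"
  shows "C11_at f x"
  unfolding C11_at_def
  using assms
  by (intro exI[of _ "\<lambda>_. Blinfun f"])
     (auto simp: bounded_linear_Blinfun_apply
       intro!: lip_at_const always_eventually bounded_linear_imp_has_derivative)

lemma C11_at_compose:
  assumes g: "C11_at g x" and f: "C11_at f (g x)"
  shows "C11_at (\<lambda>y. f (g y)) x"
proof -
  from g obtain g' where g': "\<forall>\<^sub>F y in nhds x. (g has_derivative blinfun_apply (g' y)) (at y)" "lip_at g' x"
    by (rule C11_atE)
  from f obtain f' where f': "\<forall>\<^sub>F y in nhds (g x). (f has_derivative blinfun_apply (f' y)) (at y)"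
    "lip_at f' (g x)"
    by (rule C11_atE)
  \<comment> \<open>Continuity of \<open>g\<close> pulls the neighbourhood of \<open>g x\<close> on
    which \<open>f\<close> is differentiable back to a neighbourhood of \<open>x\<close>.\<close>
  have "filterlim g (nhds (g x)) (nhds x)"
    by (rule isCont_imp_filterlim_nhds[OF C11_at_imp_isCont[OF g]])
  with f'(1) have "\<forall>\<^sub>F y in nhds x. (f has_derivative blinfun_apply (f' (g y))) (at (g y))"
    by (rule eventually_compose_filterlim)
  with g'(1) have "\<forall>\<^sub>F y in nhds x. ((\<lambda>y. f (g y)) has_derivative blinfun_apply (f' (g y) o\<^sub>L g' y)) (at y)"
  proof eventually_elim
    case (elim y)
    then show ?case
      using diff_chain_at[OF elim] by (simp add: o_def blinfun_compose.rep_eq)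
  qed
  moreover have "lip_at (\<lambda>y. f' (g y) o\<^sub>L g' y) x"
    by (intro bounded_bilinear.lip_at[OF bounded_bilinear_blinfun_compose]
         lip_at_compose[OF C11_at_imp_lip_at[OF g]] g' f')
  ultimately show ?thesis
    unfolding C11_at_def by (intro exI[of _ "\<lambda>y. f' (g y) o\<^sub>L g' y"] conjI)
qed

lemma C11_at_bounded_linear_compose:
  assumes "bounded_linear f" "C11_at g x"
  shows "C11_at (\<lambda>y. f (g y)) x"
  by (rule C11_at_compose[OF assms(2) C11_at_bounded_linear[OF assms(1)]])

lemma C11_at_add:
  assumes "C11_at f x" "C11_at g x"
  shows "C11_at (\<lambda>y. f y + g y) x"
proof -
  from assms(1) obtain f' where f': "\<forall>\<^sub>F y in nhds x. (f has_derivative blinfun_apply (f' y)) (at y)" "lip_at f' x"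
    by (rule C11_atE)
  from assms(2) obtain g' where g': "\<forall>\<^sub>F y in nhds x. (g has_derivative blinfun_apply (g' y)) (at y)" "lip_at g' x"
    by (rule C11_atE)
  from f'(1) g'(1) have "\<forall>\<^sub>F y in nhds x. ((\<lambda>y. f y + g y) has_derivative blinfun_apply (f' y + g' y)) (at y)"
    by eventually_elim (auto simp: plus_blinfun.rep_eq intro!: has_derivative_add)
  then show ?thesis
    using lip_at_add[OF f'(2) g'(2)] unfolding C11_at_def
    by (intro exI[of _ "\<lambda>y. f' y + g' y"] conjI)
qed

lemma C11_at_diff:
  assumes "C11_at f x" "C11_at g x"
  shows "C11_at (\<lambda>y. f y - g y) x"
  using C11_at_add[OF assms(1) C11_at_bounded_linear_compose[OF _ assms(2), of uminus]]
  by (simp add: bounded_linear_minus)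

text \<open>The splitting (f, g) = (f, 0) + (0, g) reduces pairs to sums and linear maps.\<close>

lemma C11_at_Pair:
  fixes f :: "'a::real_normed_vector \<Rightarrow> 'b::real_normed_vector"
    and g :: "'a \<Rightarrow> 'c::real_normed_vector"
  assumes "C11_at f x" "C11_at g x"
  shows "C11_at (\<lambda>y. (f y, g y)) x"
proof -
  have "bounded_linear (\<lambda>u. (u, 0::'c))" "bounded_linear (\<lambda>u. (0::'b, u))"
    by (auto intro!: bounded_linear_intros)
  then have "C11_at (\<lambda>y. (f y, 0) + (0, g y)) x"
    using C11_at_add[OF C11_at_bounded_linear_compose[OF _ assms(1)]
        C11_at_bounded_linear_compose[OF _ assms(2)]] by blast
  then show ?thesis by simp
qed

lemma C11_at_mult:
  fixes f g :: "'a::real_normed_vector \<Rightarrow> real"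
  assumes "C11_at f x" "C11_at g x"
  shows "C11_at (\<lambda>y. f y * g y) x"
proof -
  from assms(1) obtain f' where f': "\<forall>\<^sub>F y in nhds x. (f has_derivative blinfun_apply (f' y)) (at y)" "lip_at f' x"
    by (rule C11_atE)
  from assms(2) obtain g' where g': "\<forall>\<^sub>F y in nhds x. (g has_derivative blinfun_apply (g' y)) (at y)" "lip_at g' x"
    by (rule C11_atE)
  from f'(1) g'(1) have "\<forall>\<^sub>F y in nhds x. ((\<lambda>y. f y * g y) has_derivative blinfun_apply (f y *\<^sub>R g' y + g y *\<^sub>R f' y)) (at y)"
  proof eventually_elim
    case (elim y)
    show ?case
      by (rule has_derivative_eq_rhs[OF has_derivative_mult[OF elim]])
         (auto simp: blinfun.bilinear_simps algebra_simps)
  qed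
  moreover have "lip_at (\<lambda>y. f y *\<^sub>R g' y + g y *\<^sub>R f' y) x"
    by (intro lip_at_add bounded_bilinear.lip_at[OF bounded_bilinear_scaleR] C11_at_imp_lip_at assms f' g')
  ultimately show ?thesis
    unfolding C11_at_def by (intro exI[of _ "\<lambda>y. f y *\<^sub>R g' y + g y *\<^sub>R f' y"] conjI)
qed

section \<open>Scalar functions: exponential and logarithm\<close>

lemma real_derivative_imp_lip_at:
  fixes f f' :: "real \<Rightarrow> real"
  assumes "\<forall>\<^sub>F y in nhds x. (f has_real_derivative f' y) (at y)" and "isCont f' x"
  shows "lip_at f x"
proof (rule has_derivative_bounded_imp_lip_at)
  \<comment> \<open>The number \<open>f' y\<close> becomes the operator of multiplication by it;
    \<open>blinfun_scaleR_left\<close> is bounded linear in that number, so continuity carries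
    over.\<close>
  show "\<forall>\<^sub>F y in nhds x. (f has_derivative blinfun_scaleR_left (f' y)) (at y)"
    using assms(1) by (auto simp: has_field_derivative_def mult.commute[of _ "f' _"] elim!: eventually_mono)
  have "isCont (\<lambda>y. blinfun_scaleR_left (f' y) :: real \<Rightarrow>\<^sub>L real) x"
    by (intro bounded_linear.isCont[OF bounded_linear_blinfun_scaleR_left] assms)
  then show "\<forall>\<^sub>F y in nhds x. norm (blinfun_scaleR_left (f' y) :: real \<Rightarrow>\<^sub>L real)
      \<le> norm (blinfun_scaleR_left (f' x) :: real \<Rightarrow>\<^sub>L real) + 1"
    by (rule isCont_imp_bounded_nhds)
qed

lemma real_derivative_imp_C11_at:
  fixes f f' f'' :: "real \<Rightarrow> real"
  assumes "\<forall>\<^sub>F y in nhds x. (f has_real_derivative f' y) (at y)"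
    and "\<forall>\<^sub>F y in nhds x. (f' has_real_derivative f'' y) (at y)" and "isCont f'' x"
  shows "C11_at f x"
  unfolding C11_at_def
proof (intro exI conjI)
  show "\<forall>\<^sub>F y in nhds x. (f has_derivative blinfun_scaleR_left (f' y)) (at y)"
    using assms(1) by (auto simp: has_field_derivative_def mult.commute[of _ "f' _"] elim!: eventually_mono)
  have "lip_at f' x"
    by (rule real_derivative_imp_lip_at[OF assms(2,3)])
  moreover have "lip_at (blinfun_scaleR_left :: real \<Rightarrow> real \<Rightarrow>\<^sub>L real) (f' x)"
    by (intro C11_at_imp_lip_at C11_at_bounded_linear bounded_linear_blinfun_scaleR_left)
  ultimately show "lip_at (\<lambda>y. blinfun_scaleR_left (f' y) :: real \<Rightarrow>\<^sub>L real) x"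
    by (rule lip_at_compose)
qed

text \<open>Exponential and logarithm suffice for the scheme: on positive arguments its power with
  variable base and exponent is exp of \<open>r\<close> times a difference of logarithms.\<close>

lemma C11_at_exp:
  fixes f :: "'a::real_normed_vector \<Rightarrow> real"
  assumes "C11_at f x"
  shows "C11_at (\<lambda>y. exp (f y)) x"
  by (rule C11_at_compose[OF assms real_derivative_imp_C11_at[where f' = exp and f'' = exp]])
     (auto intro!: always_eventually DERIV_exp)

lemma C11_at_ln:
  fixes f :: "'a::real_normed_vector \<Rightarrow> real"
  assumes "C11_at f x" "f x > 0"
  shows "C11_at (\<lambda>y. ln (f y)) x"
proof (rule C11_at_compose[OF assms(1)])
  have pos: "\<forall>\<^sub>F y in nhds (f x). y > 0"
    using assms(2) eventually_nhds_in_open[of "{0<..}" "f x"] by simp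
  show "C11_at ln (f x)"
  proof (rule real_derivative_imp_C11_at)
    show "\<forall>\<^sub>F y in nhds (f x). (ln has_real_derivative inverse y) (at y)"
      using pos by eventually_elim (auto intro: DERIV_ln)
    show "\<forall>\<^sub>F y in nhds (f x). (inverse has_real_derivative - (inverse y ^ Suc (Suc 0))) (at y)"
      using pos by eventually_elim (simp only: DERIV_inverse)
  qed (use assms(2) in \<open>auto intro!: continuous_intros\<close>)
qed

section \<open>Inverse and implicit functions\<close>

text \<open>Inverses stay bounded near \<open>x\<close>, by twice \<open>norm (S x)\<close>. Mere
  continuity of \<open>T\<close> is assumed, because the bound is applied to a local inverse before
  that inverse is known to be Lipschitz.\<close>

lemma bounded_blinfun_inverse:
  fixes T :: "'a::metric_space \<Rightarrow> 'b::real_normed_vector \<Rightarrow>\<^sub>L 'c::real_normed_vector"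
  assumes "isCont T x"
    and inv: "\<forall>\<^sub>F y in nhds x. S y o\<^sub>L T y = id_blinfun \<and> T y o\<^sub>L S y = id_blinfun"
  shows "\<exists>B. \<forall>\<^sub>F y in nhds x. norm (S y) \<le> B"
proof -
  define K where "K = norm (S x)"
  have Sx: "T x o\<^sub>L S x = id_blinfun"
    using eventually_nhds_x_imp_x[OF inv] by blast
  \<comment> \<open>The radius makes \<open>norm (T x - T y) * K\<close> at most 1/2; the added 1
    avoids a zero denominator when \<open>K = 0\<close>.\<close>
  have "\<forall>\<^sub>F y in nhds x. dist (T y) (T x) < 1 / (2 * (K + 1))"
    using assms(1) unfolding isCont_def tendsto_iff eventually_nhds_conv_at
    by (simp add: K_def add_nonneg_pos)
  then have "\<forall>\<^sub>F y in nhds x. norm (S y) \<le> 2 * K"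
    using inv
  proof eventually_elim
    case (elim y)
    \<comment> \<open>Resolvent identity; the last factor makes the second summand at most half of \<open>norm (S y)\<close>.\<close>
    have "S y = S x + (S y o\<^sub>L ((T x - T y) o\<^sub>L S x))"
    proof (rule blinfun_eqI)
      fix v
      have 1: "blinfun_apply (T x) (blinfun_apply (S x) v) = v"
        using arg_cong[OF Sx, of "\<lambda>A. blinfun_apply A v"] by simp
      have 2: "blinfun_apply (S y) (blinfun_apply (T y) w) = w" for w
        using arg_cong[of _ _ "\<lambda>A. blinfun_apply A w"] elim by (metis blinfun_apply_blinfun_compose blinfun_apply_id_blinfun)
      show "S y v = (S x + (S y o\<^sub>L ((T x - T y) o\<^sub>L S x))) v"
        by (simp add: blinfun.bilinear_simps 1 2)
    qed
    then have "norm (S y) \<le> norm (S x) + norm (S y o\<^sub>L ((T x - T y) o\<^sub>L S x))"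
      by (metis norm_triangle_ineq)
    also have "norm (S y o\<^sub>L ((T x - T y) o\<^sub>L S x)) \<le> norm (S y) * (norm (T x - T y) * norm (S x))"
      by (rule order_trans[OF norm_blinfun_compose]) (intro mult_left_mono norm_blinfun_compose norm_ge_zero)
    also have "\<dots> \<le> norm (S y) * (1 / 2)"
    proof (intro mult_left_mono norm_ge_zero)
      have "norm (T x - T y) * norm (S x) \<le> 1 / (2 * (K + 1)) * K"
        using elim unfolding K_def by (intro mult_right_mono) (auto simp: dist_norm norm_minus_commute)
      also have "\<dots> \<le> 1 / 2"
        unfolding K_def using norm_ge_zero[of "S x"] by (simp add: field_simps add_pos_nonneg)
      finally show "norm (T x - T y) * norm (S x) \<le> 1 / 2" .
    qed
    finally show ?case by (simp add: K_def)
  qed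
  then show ?thesis by blast
qed

lemma lip_at_blinfun_inverse:
  fixes T :: "'a::metric_space \<Rightarrow> 'b::real_normed_vector \<Rightarrow>\<^sub>L 'c::real_normed_vector"
  assumes T: "lip_at T x"
    and inv: "\<forall>\<^sub>F y in nhds x. S y o\<^sub>L T y = id_blinfun \<and> T y o\<^sub>L S y = id_blinfun"
  shows "lip_at S x"
proof -
  from bounded_blinfun_inverse[OF lip_at_imp_isCont[OF T] inv]
  obtain B where B: "\<forall>\<^sub>F y in nhds x. norm (S y) \<le> B" by blast
  from T obtain d L where d: "d > 0" "L \<ge> 0"
    "\<And>y z. dist y x < d \<Longrightarrow> dist z x < d \<Longrightarrow> dist (T y) (T z) \<le> L * dist y z"
    by (rule lip_atE) blast
  from eventually_conj[OF B inv] obtain e where e: "e > 0"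
    "\<And>y. dist y x < e \<Longrightarrow> norm (S y) \<le> B \<and> S y o\<^sub>L T y = id_blinfun \<and> T y o\<^sub>L S y = id_blinfun"
    unfolding eventually_nhds_metric by blast
  show ?thesis
  proof (rule lip_atI'[of "min d e" _ _ "B * (L * B)"])
    fix y z assume yz: "dist y x < min d e" "dist z x < min d e"
    \<comment> \<open>Resolvent identity, with \<open>S y\<close> as a left inverse of
      \<open>T y\<close> and \<open>S z\<close> as a right inverse of \<open>T z\<close>. It bounds
      the difference of the inverses by that of the operators.\<close>
    have "S y - S z = S y o\<^sub>L ((T z - T y) o\<^sub>L S z)"
    proof (rule blinfun_eqI)
      fix v
      have 1: "blinfun_apply (T z) (blinfun_apply (S z) v) = v"
        and 2: "blinfun_apply (S y) (blinfun_apply (T y) w) = w" for w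
        using e(2)[of y] e(2)[of z] yz
        by (metis blinfun_apply_blinfun_compose blinfun_apply_id_blinfun min_less_iff_conj)+
      show "(S y - S z) v = (S y o\<^sub>L ((T z - T y) o\<^sub>L S z)) v"
        by (simp add: blinfun.bilinear_simps 1 2)
    qed
    then have "dist (S y) (S z) = norm (S y o\<^sub>L ((T z - T y) o\<^sub>L S z))"
      by (simp add: dist_norm)
    also have "\<dots> \<le> norm (S y) * (norm (T z - T y) * norm (S z))"
      by (rule order_trans[OF norm_blinfun_compose]) (intro mult_left_mono norm_blinfun_compose norm_ge_zero)
    also have "\<dots> \<le> B * (L * dist y z * B)"
      using e(2)[of y] e(2)[of z] d(3)[of y z] d(2) yz
      by (intro mult_mono) (auto simp: dist_norm norm_minus_commute intro: order_trans[OF norm_ge_zero])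
    finally show "dist (S y) (S z) \<le> B * (L * B) * dist y z"
      by (simp add: mult_ac)
  qed (use d e in auto)
qed

section \<open>Local inverses and implicit functions\<close>

text \<open>Bootstrapping on the fact that the derivative of the local inverse \<open>g\<close> at
  \<open>y\<close> inverts \<open>f' (g y)\<close>: bounded inverses make \<open>g\<close>
  Lipschitz, then \<open>f'\<close> composed with \<open>g\<close> is Lipschitz, and then so are the
  inverse operators.\<close>

lemma C11_at_local_inverse:
  fixes F :: "'a::euclidean_space \<Rightarrow> 'a"
  assumes F: "C11_at F x0" and F0: "(F has_derivative F0) (at x0)" "inj F0"
  obtains G where "C11_at G (F x0)" "G (F x0) = x0" "\<forall>\<^sub>F y in nhds (F x0). F (G y) = y"
proof -
  from F obtain f' where f': "\<forall>\<^sub>F y in nhds x0. (F has_derivative blinfun_apply (f' y)) (at y)" "lip_at f' x0"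
    by (rule C11_atE)
  from f'(2) obtain d L where d: "d > 0" "L-lipschitz_on (ball x0 d) f'"
    unfolding lip_at_def by blast
  from f'(1) obtain e where e: "e > 0" "\<And>y. dist y x0 < e \<Longrightarrow> (F has_derivative blinfun_apply (f' y)) (at y)"
    unfolding eventually_nhds_metric by blast
  \<comment> \<open>On this ball \<open>F\<close> is differentiable and \<open>f'\<close> is
    Lipschitz, hence continuous, as the inverse function theorem requires.\<close>
  define U where "U = ball x0 (min d e)"
  have U: "open U" "x0 \<in> U"
    using d e by (auto simp: U_def)
  have der: "(F has_derivative blinfun_apply (f' y)) (at y)" if "y \<in> U" for y
    using e that by (auto simp: U_def dist_commute)
  have cont: "continuous_on U f'"
    by (rule lipschitz_on_continuous_on[OF lipschitz_on_subset[OF d(2)]]) (auto simp: U_def)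
  have F0_eq: "F0 = blinfun_apply (f' x0)"
    using has_derivative_unique[OF F0(1) der[OF U(2)]] .
  then have "linear F0"
    by (simp add: blinfun.bounded_linear_right bounded_linear.linear)
  with F0(2) obtain j where j: "linear j" "j \<circ> F0 = id"
    using linear_injective_left_inverse by blast
  have "Blinfun j o\<^sub>L f' x0 = id_blinfun"
    using j by (intro blinfun_eqI)
      (auto simp: bounded_linear_Blinfun_apply linear_conv_bounded_linear[symmetric] F0_eq fun_eq_iff)
  from inverse_function_theorem[OF U(1) der cont U(2) this]
  obtain U' V g g' where UV: "open U'" "U' \<subseteq> U" "x0 \<in> U'" "open V" "F x0 \<in> V"
    and hom: "homeomorphism U' V F g"
    and g': "\<And>y. y \<in> V \<Longrightarrow> (g has_derivative (g' y)) (at y)"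
      "\<And>y. y \<in> V \<Longrightarrow> g' y = inv (blinfun_apply (f'(g y)))"
      "\<And>y. y \<in> V \<Longrightarrow> bij (blinfun_apply (f'(g y)))"
    by metis
  have gF: "g (F x0) = x0"
    using hom UV(3) by (rule homeomorphism_apply1)
  have evV: "\<forall>\<^sub>F y in nhds (F x0). y \<in> V"
    using UV by (intro eventually_nhds_in_open)
  have app: "blinfun_apply (Blinfun (g' y)) = g' y" if "y \<in> V" for y
    using g'(1)[OF that] by (simp add: bounded_linear_Blinfun_apply has_derivative_bounded_linear)
  have derg: "\<forall>\<^sub>F y in nhds (F x0). (g has_derivative blinfun_apply (Blinfun (g' y))) (at y)"
    using evV by eventually_elim (simp add: app g'(1))
  have inv: "\<forall>\<^sub>F y in nhds (F x0). Blinfun (g' y) o\<^sub>L f' (g y) = id_blinfun \<and> f' (g y) o\<^sub>L Blinfun (g' y) = id_blinfun"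
    using evV
  proof eventually_elim
    case (elim y)
    then show ?case
      using g'(3)[OF elim] unfolding bij_def
      by (intro conjI blinfun_eqI)
         (simp_all add: app[OF elim], simp_all add: g'(2)[OF elim] inv_f_f surj_f_inv_f)
  qed
  have contg: "isCont g (F x0)"
    using g'(1)[OF UV(5)] by (rule has_derivative_continuous)
  \<comment> \<open>Only continuity of \<open>g\<close> is available at this stage; it is enough to
    bound the inverses.\<close>
  have "isCont (\<lambda>y. f' (g y)) (F x0)"
    using contg lip_at_imp_isCont[OF f'(2)] by (intro isCont_o2[OF contg]) (simp add: gF)
  from bounded_blinfun_inverse[OF this inv]
  obtain B where "\<forall>\<^sub>F y in nhds (F x0). norm (Blinfun (g' y)) \<le> B" by blast
  with derg have "lip_at g (F x0)"
    by (rule has_derivative_bounded_imp_lip_at)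
  then have "lip_at (\<lambda>y. f' (g y)) (F x0)"
    using lip_at_compose[of g "F x0" f'] f'(2) by (simp add: gF)
  then have "lip_at (\<lambda>y. Blinfun (g' y)) (F x0)"
    using inv by (rule lip_at_blinfun_inverse)
  with derg have "C11_at g (F x0)"
    unfolding C11_at_def by (intro exI[of _ "\<lambda>y. Blinfun (g' y)"] conjI)
  moreover have "\<forall>\<^sub>F y in nhds (F x0). F (g y) = y"
    using evV by eventually_elim (rule homeomorphism_apply2[OF hom])
  ultimately show ?thesis
    using gF that by blast
qed

text \<open>The map (y, x) -> (y, G (y, x)) is locally invertible, and the solution is the second
  component of its inverse at (y, 0).\<close>

lemma C11_at_implicit:
  fixes G :: "'a::euclidean_space \<times> real \<Rightarrow> real"
  assumes G: "C11_at G (y0, x0)" "G (y0, x0) = 0"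
    and G0: "(G has_derivative G0) (at (y0, x0))" "G0 (0, 1) \<noteq> 0"
  obtains h where "C11_at h y0" "h y0 = x0" "\<forall>\<^sub>F y in nhds y0. G (y, h y) = 0"
proof -
  define F where "F = (\<lambda>p. (fst p, G p))"
  have "C11_at F (y0, x0)"
    unfolding F_def by (intro C11_at_Pair C11_at_bounded_linear bounded_linear_fst G)
  moreover have F0: "(F has_derivative (\<lambda>v. (fst v, G0 v))) (at (y0, x0))"
    unfolding F_def using G0 by (auto intro!: derivative_eq_intros)
  moreover have "inj (\<lambda>v. (fst v, G0 v))"
  proof -
    have lin: "linear G0"
      using G0(1) by (rule has_derivative_linear)
    have "v = 0" if "(fst v, G0 v) = 0" for v
    proof -
      \<comment> \<open>The first component of \<open>v\<close> vanishes, so \<open>G0 v\<close> is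
        \<open>snd v\<close> times the nonzero number \<open>G0 (0, 1)\<close>.\<close>
      have "v = snd v *\<^sub>R (0, 1)"
        using that by (auto simp: prod_eq_iff)
      then have "G0 v = snd v * G0 (0, 1)"
        by (metis linear_scale[OF lin] real_scaleR_def)
      then show ?thesis
        using that G0(2) by (auto simp: prod_eq_iff)
    qed
    then show ?thesis
      using linear_injective_0[OF has_derivative_linear[OF F0]] by blast
  qed
  ultimately obtain \<Psi> where \<Psi>: "C11_at \<Psi> (F (y0, x0))" "\<Psi> (F (y0, x0)) = (y0, x0)"
    "\<forall>\<^sub>F p in nhds (F (y0, x0)). F (\<Psi> p) = p"
    by (rule C11_at_local_inverse)
  have F_y0: "F (y0, x0) = (y0, 0)"
    using G by (simp add: F_def)
  have emb: "C11_at (\<lambda>y. (y, 0::real)) y0"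
    by (intro C11_at_Pair C11_at_const C11_at_bounded_linear bounded_linear_ident)
  define h where "h = (\<lambda>y. snd (\<Psi> (y, 0)))"
  have "C11_at h y0"
    unfolding h_def using \<Psi>(1)
    by (intro C11_at_bounded_linear_compose[OF bounded_linear_snd] C11_at_compose[OF emb])
       (simp add: F_y0)
  moreover have "h y0 = x0"
    using \<Psi>(2) by (simp add: h_def F_y0)
  moreover have "\<forall>\<^sub>F y in nhds y0. F (\<Psi> (y, 0)) = (y, 0)"
  proof -
    have "filterlim (\<lambda>y. (y, 0::real)) (nhds (y0, 0)) (nhds y0)"
      using isCont_imp_filterlim_nhds[OF C11_at_imp_isCont[OF emb]] .
    with \<Psi>(3) show ?thesis
      unfolding F_y0 by (rule eventually_compose_filterlim)
  qed
  \<comment> \<open>The first component gives \<open>fst (\<Psi> (y, 0)) = y\<close>; the second is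
    then the equation for \<open>h y\<close>.\<close>
  then have "\<forall>\<^sub>F y in nhds y0. G (y, h y) = 0"
  proof eventually_elim
    case (elim y)
    then show ?case
      by (cases "\<Psi> (y, 0)") (simp add: F_def h_def)
  qed
  ultimately show ?thesis
    by (rule that)
qed

section \<open>Gluing along a hyperplane\<close>

text \<open>Both candidates share value and linearisation at \<open>y\<close>, so the same error
  estimate applies whichever of them \<open>f\<close> follows at a nearby point.\<close>

lemma has_derivative_at_either:
  fixes f f1 f2 :: "'a::real_normed_vector \<Rightarrow> 'b::real_normed_vector"
  assumes f1: "(f1 has_derivative D) (at y)" "f y = f1 y"
    and f2: "(f2 has_derivative D) (at y)" "f y = f2 y"
    and ev: "\<forall>\<^sub>F z in nhds y. f z = f1 z \<or> f z = f2 z"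
  shows "(f has_derivative D) (at y)"
  unfolding has_derivative_at_alt
proof (intro conjI allI impI)
  show "bounded_linear D" using f1(1) by (rule has_derivative_bounded_linear)
  fix \<epsilon> :: real assume "\<epsilon> > 0"
  with f1(1) obtain u1 where u1: "u1 > 0"
    "\<And>z. norm (z - y) < u1 \<Longrightarrow> norm (f1 z - f1 y - D (z - y)) \<le> \<epsilon> * norm (z - y)"
    unfolding has_derivative_at_alt by blast
  from \<open>\<epsilon> > 0\<close> f2(1) obtain u2 where u2: "u2 > 0"
    "\<And>z. norm (z - y) < u2 \<Longrightarrow> norm (f2 z - f2 y - D (z - y)) \<le> \<epsilon> * norm (z - y)"
    unfolding has_derivative_at_alt by blast
  from ev obtain u where u: "u > 0" "\<And>z. norm (z - y) < u \<Longrightarrow> f z = f1 z \<or> f z = f2 z"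
    unfolding eventually_nhds_metric dist_norm by blast
  show "\<exists>d>0. \<forall>z. norm (z - y) < d \<longrightarrow> norm (f z - f y - D (z - y)) \<le> \<epsilon> * norm (z - y)"
    using u u1 u2 f1(2) f2(2) by (intro exI[of _ "min u (min u1 u2)"]) fastforce
qed

text \<open>The two derivatives coincide on the hyperplane \<open>W = 0\<close>. For points on
  opposite sides, the segment between them meets the hyperplane, and the Lipschitz estimates on the
  two pieces of the segment add up.\<close>

lemma C11_at_glue:
  fixes f f1 f2 :: "'a::real_normed_vector \<Rightarrow> 'b::real_normed_vector"
  assumes W: "bounded_linear W"
    and f1: "C11_at f1 x" "\<forall>\<^sub>F y in nhds x. W y \<ge> 0 \<longrightarrow> f y = f1 y"
    and f2: "C11_at f2 x" "\<forall>\<^sub>F y in nhds x. W y \<le> 0 \<longrightarrow> f y = f2 y"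
    and D: "\<forall>\<^sub>F y in nhds x. W y = (0::real) \<longrightarrow>
      (\<exists>D. (f1 has_derivative D) (at y) \<and> (f2 has_derivative D) (at y))"
  shows "C11_at f x"
proof -
  interpret W: bounded_linear W by (rule W)
  from f1(1) obtain f1' where f1': "\<forall>\<^sub>F y in nhds x. (f1 has_derivative blinfun_apply (f1' y)) (at y)" "lip_at f1' x"
    by (rule C11_atE)
  from f2(1) obtain f2' where f2': "\<forall>\<^sub>F y in nhds x. (f2 has_derivative blinfun_apply (f2' y)) (at y)" "lip_at f2' x"
    by (rule C11_atE)
  from f1'(2) obtain d1 L1 where L1: "d1 > 0" "L1 \<ge> 0"
    "\<And>y z. dist y x < d1 \<Longrightarrow> dist z x < d1 \<Longrightarrow> dist (f1' y) (f1' z) \<le> L1 * dist y z"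
    by (rule lip_atE) blast
  from f2'(2) obtain d2 L2 where L2: "d2 > 0" "L2 \<ge> 0"
    "\<And>y z. dist y x < d2 \<Longrightarrow> dist z x < d2 \<Longrightarrow> dist (f2' y) (f2' z) \<le> L2 * dist y z"
    by (rule lip_atE) blast
  have "\<forall>\<^sub>F y in nhds x. (f1 has_derivative blinfun_apply (f1' y)) (at y) \<and>
      (f2 has_derivative blinfun_apply (f2' y)) (at y) \<and> (W y \<ge> 0 \<longrightarrow> f y = f1 y) \<and>
      (W y \<le> 0 \<longrightarrow> f y = f2 y) \<and> (W y = 0 \<longrightarrow>
      (\<exists>D. (f1 has_derivative D) (at y) \<and> (f2 has_derivative D) (at y)))"
    using f1' f1(2) f2' f2(2) D by (simp add: eventually_conj_iff)
  then obtain e0 where e0: "e0 > 0" "\<And>y. dist y x < e0 \<Longrightarrow> (f1 has_derivative blinfun_apply (f1' y)) (at y) \<and>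
      (f2 has_derivative blinfun_apply (f2' y)) (at y) \<and> (W y \<ge> 0 \<longrightarrow> f y = f1 y) \<and>
      (W y \<le> 0 \<longrightarrow> f y = f2 y) \<and> (W y = 0 \<longrightarrow>
      (\<exists>D. (f1 has_derivative D) (at y) \<and> (f2 has_derivative D) (at y)))"
    unfolding eventually_nhds_metric by blast
  define e where "e = min e0 (min d1 d2)"
  have "e > 0" using e0 L1 L2 by (simp add: e_def)
  define N where "N = ball x e"
  have N: "open N" "convex N" "x \<in> N" using \<open>e > 0\<close> by (auto simp: N_def)
  have f1N: "(f1 has_derivative blinfun_apply (f1' y)) (at y)" "W y \<ge> 0 \<Longrightarrow> f y = f1 y"
    and f2N: "(f2 has_derivative blinfun_apply (f2' y)) (at y)" "W y \<le> 0 \<Longrightarrow> f y = f2 y"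
    and DN: "W y = 0 \<Longrightarrow> \<exists>D. (f1 has_derivative D) (at y) \<and> (f2 has_derivative D) (at y)"
    if "y \<in> N" for y
    using e0(2)[of y] that by (auto simp: N_def e_def dist_commute)
  have L1N: "dist (f1' y) (f1' z) \<le> L1 * dist y z"
    and L2N: "dist (f2' y) (f2' z) \<le> L2 * dist y z" if "y \<in> N" "z \<in> N" for y z
    using L1(3)[of y z] L2(3)[of y z] that by (auto simp: N_def e_def dist_commute)
  have eq: "f1' y = f2' y" if y: "y \<in> N" "W y = 0" for y
  proof -
    from DN[OF y] obtain D where "(f1 has_derivative D) (at y)" "(f2 has_derivative D) (at y)" by blast
    then have "D = blinfun_apply (f1' y)" "D = blinfun_apply (f2' y)"
      using f1N(1)[OF y(1)] f2N(1)[OF y(1)] has_derivative_unique by blast+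
    then show ?thesis by (simp add: blinfun_apply_inject)
  qed
  \<comment> \<open>By \<open>eq\<close>, the choice made on \<open>W y = 0\<close> is immaterial
    inside \<open>N\<close>.\<close>
  define f' where "f' = (\<lambda>y. if W y \<ge> 0 then f1' y else f2' y)"
  have der: "(f has_derivative blinfun_apply (f' y)) (at y)" if y: "y \<in> N" for y
  proof -
    consider "W y > 0" | "W y < 0" | "W y = 0" by linarith
    then show ?thesis
    proof cases
      case 1
      have "(f has_derivative blinfun_apply (f1' y)) (at y)"
      proof (rule has_derivative_transform_within_open[OF f1N(1)[OF y]])
        show "open (N \<inter> W -` {0<..})"
          using N(1) W.continuous_on[OF continuous_on_id]
          by (intro open_Int open_vimage) auto
      qed (use 1 y f1N(2) in auto)
      then show ?thesis using 1 by (simp add: f'_def)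
    next
      case 2
      have "(f has_derivative blinfun_apply (f2' y)) (at y)"
      proof (rule has_derivative_transform_within_open[OF f2N(1)[OF y]])
        show "open (N \<inter> W -` {..<0})"
          using N(1) W.continuous_on[OF continuous_on_id]
          by (intro open_Int open_vimage) auto
      qed (use 2 y f2N(2) in auto)
      then show ?thesis using 2 by (simp add: f'_def)
    next
      case 3
      have "(f has_derivative blinfun_apply (f1' y)) (at y)"
      proof (rule has_derivative_at_either[where ?f1.0 = f1 and ?f2.0 = f2])
        show "(f2 has_derivative blinfun_apply (f1' y)) (at y)"
          using f2N(1)[OF y] eq[OF y 3] by simp
        show "\<forall>\<^sub>F z in nhds y. f z = f1 z \<or> f z = f2 z"
          using eventually_nhds_in_open[OF N(1) y]
        proof eventually_elim
          case (elim z)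
          then show ?case using f1N(2) f2N(2) by (cases "W z \<ge> 0") auto
        qed
      qed (use f1N[OF y] f2N[OF y] 3 in auto)
      then show ?thesis using 3 by (simp add: f'_def)
    qed
  qed
  define L where "L = max L1 L2"
  have cross: "dist (f1' y) (f2' z) \<le> L * dist y z" if yz: "y \<in> N" "z \<in> N" "W y \<ge> 0" "W z < 0" for y z
  proof -
    \<comment> \<open>The parameter at which \<open>W\<close>, affine along the segment from
      \<open>y\<close> to \<open>z\<close>, vanishes; the denominator is positive.\<close>
    define t where "t = W y / (W y - W z)"
    have t: "0 \<le> t" "t \<le> 1" using yz by (auto simp: t_def field_simps)
    define u where "u = (1 - t) *\<^sub>R y + t *\<^sub>R z"
    have "u \<in> N"
      using N(2) yz t unfolding convex_alt u_def by simp
    have "W u = (1 - t) * W y + t * W z"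
      by (simp add: u_def W.add W.scale)
    also have "\<dots> = 0"
      using yz by (simp add: t_def field_simps)
    finally have "f1' u = f2' u"
      by (rule eq[OF \<open>u \<in> N\<close>])
    then have "dist (f1' y) (f2' z) \<le> dist (f1' y) (f1' u) + dist (f2' u) (f2' z)"
      by (metis dist_triangle)
    also have "\<dots> \<le> L * dist y u + L * dist u z"
      using L1N[OF yz(1) \<open>u \<in> N\<close>] L2N[OF \<open>u \<in> N\<close> yz(2)]
        mult_right_mono[of L1 L "dist y u"] mult_right_mono[of L2 L "dist u z"]
      by (simp add: L_def)
    \<comment> \<open>The point \<open>u\<close> lies on the segment, so the two distances add up
      exactly and the constant \<open>L\<close> is kept.\<close>
    also have "\<dots> = L * dist y z"
    proof -
      have "y - u = t *\<^sub>R (y - z)" "u - z = (1 - t) *\<^sub>R (y - z)"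
        by (simp_all add: u_def algebra_simps)
      then have "dist y u = t * dist y z" "dist u z = (1 - t) * dist y z"
        using t by (simp_all add: dist_norm)
      then show ?thesis by (simp only:) (simp add: algebra_simps)
    qed
    finally show ?thesis .
  qed
  have "lip_at f' x"
  proof (rule lip_atI'[OF \<open>e > 0\<close>])
    fix y z assume "dist y x < e" "dist z x < e"
    then have yz: "y \<in> N" "z \<in> N" by (auto simp: N_def dist_commute)
    have "L1 * dist y z \<le> L * dist y z" "L2 * dist y z \<le> L * dist y z"
      by (auto simp: L_def intro: mult_right_mono)
    then show "dist (f' y) (f' z) \<le> L * dist y z"
      using L1N[OF yz] L2N[OF yz] cross[OF yz] cross[OF yz(2,1)]
      by (auto simp: f'_def dist_commute)
  qed
  moreover have "\<forall>\<^sub>F y in nhds x. (f has_derivative blinfun_apply (f' y)) (at y)"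
    using eventually_nhds_in_open[OF N(1,3)] by eventually_elim (rule der)
  ultimately show ?thesis
    unfolding C11_at_def by (intro exI[of _ f'] conjI)
qed

section \<open>The gBBKS1 map\<close>

lemma open_pos_orthant: "open pos_orthant"
proof -
  have eq: "pos_orthant = (\<Inter>i. {y. 0 < y $ i})"
    by (auto simp: pos_orthant_def)
  show ?thesis
    unfolding eq by (intro open_INT ballI finite open_Collect_less continuous_intros)
qed

text \<open>
  The factor \<open>w y\<close> vanishes at \<open>y0\<close>, so the partial derivative in the unknown is 1 there whatever \<open>\<kappa>\<close> is;
  this is why \<open>h\<close> exists on both sides of \<open>w = 0\<close>.
\<close>

lemma implicit_powr_stage:
  fixes w l s r :: "'a::euclidean_space \<Rightarrow> real" and \<kappa> :: real
  assumes w: "bounded_linear w" "w y0 = 0" and l: "bounded_linear l" "l y0 > 0"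
    and s: "C11_at s y0" "s y0 > 0" and r: "C11_at r y0"
  obtains h \<phi> where "C11_at \<phi> y0" "\<forall>\<^sub>F y in nhds y0. h y > 0 \<and>
    \<phi> y = (h y / s y) powr r y \<and> h y + \<kappa> * w y * \<phi> y = l y"
proof -
  \<comment> \<open>The power \<open>(x / s y) powr r y\<close> in exp-ln form, which the calculus
    rules cover; the two agree for positive \<open>x\<close> and \<open>s y\<close>.\<close>
  define E where "E = (\<lambda>p. exp (r (fst p) * (ln (snd p) - ln (s (fst p)))))"
  define G where "G = (\<lambda>p. snd p + \<kappa> * (w (fst p) * E p) - l (fst p))"
  have comp_fst: "C11_at (\<lambda>p. k (fst p)) (y0, l y0)" if "C11_at k y0" for k :: "'a \<Rightarrow> real"
    using C11_at_compose[OF C11_at_bounded_linear[OF bounded_linear_fst], of k "(y0, l y0)"] that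
    by simp
  have E: "C11_at E (y0, l y0)"
    unfolding E_def using s l
    by (intro C11_at_exp C11_at_mult C11_at_diff C11_at_ln comp_fst[OF r] comp_fst[OF s(1)]
        C11_at_bounded_linear bounded_linear_snd) auto
  then obtain E' where "\<forall>\<^sub>F p in nhds (y0, l y0). (E has_derivative blinfun_apply (E' p)) (at p)"
    by (rule C11_atE)
  from eventually_nhds_x_imp_x[OF this]
  obtain E0 where E0: "(E has_derivative E0) (at (y0, l y0))" ..
  have "C11_at G (y0, l y0)"
    unfolding G_def
    by (intro C11_at_diff C11_at_add C11_at_mult C11_at_const E bounded_linear_snd
        comp_fst[OF C11_at_bounded_linear[OF w(1)]] comp_fst[OF C11_at_bounded_linear[OF l(1)]]
        C11_at_bounded_linear[OF bounded_linear_snd])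
  moreover have "G (y0, l y0) = 0"
    by (simp add: G_def w)
  \<comment> \<open>\<open>E0\<close> can stay unspecified, since its coefficient contains
    \<open>w y0 = 0\<close>.\<close>
  moreover have "(G has_derivative
      (\<lambda>v. snd v + \<kappa> * (w (fst (y0, l y0)) * E0 v + w (fst v) * E (y0, l y0)) - l (fst v))) (at (y0, l y0))"
    unfolding G_def
    by (intro has_derivative_diff has_derivative_add has_derivative_mult_right has_derivative_mult E0
        bounded_linear.has_derivative[OF w(1)] bounded_linear.has_derivative[OF l(1)]
        has_derivative_fst has_derivative_snd has_derivative_ident)
  ultimately obtain h where h: "C11_at h y0" "h y0 = l y0" "\<forall>\<^sub>F y in nhds y0. G (y, h y) = 0"
    by (rule C11_at_implicit) (simp add: w bounded_linear.linear linear_0 linear_simps[OF w(1)] linear_simps[OF l(1)])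
  \<comment> \<open>This is \<open>E\<close> along the solution:
    \<open>\<phi> y = E (y, h y)\<close>.\<close>
  define \<phi> where "\<phi> = (\<lambda>y. exp (r y * (ln (h y) - ln (s y))))"
  have "C11_at \<phi> y0"
    unfolding \<phi>_def using s r h l by (intro C11_at_exp C11_at_mult C11_at_diff C11_at_ln) auto
  moreover have "\<forall>\<^sub>F y in nhds y0. h y > 0 \<and> \<phi> y = (h y / s y) powr r y \<and> h y + \<kappa> * w y * \<phi> y = l y"
  proof -
    have pos: "\<forall>\<^sub>F y in nhds y0. k y > 0" if "C11_at k y0" "k y0 > 0" for k :: "'a \<Rightarrow> real"
      using eventually_compose_filterlim[OF eventually_nhds_in_open[of "{0<..}" "k y0"]
          isCont_imp_filterlim_nhds[OF C11_at_imp_isCont[OF that(1)]]] that(2)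
      by simp
    have "h y0 > 0"
      using h(2) l(2) by simp
    from h(3) pos[OF h(1) this] pos[OF s] show ?thesis
    proof eventually_elim
      case (elim y)
      have "\<phi> y = (h y / s y) powr r y"
        using elim(2,3) by (simp add: \<phi>_def powr_def ln_div)
      moreover have "h y + \<kappa> * w y * \<phi> y = l y"
        using elim(1) by (simp only: \<phi>_def G_def E_def fst_conv snd_conv mult.assoc)
      ultimately show ?case
        using elim(2) by blast
    qed
  qed
  ultimately show ?thesis
    by (rule that)
qed

section \<open>Solution of the implicit scheme\<close>

text \<open>A positive coefficient and a positive exponent make both sides strictly increasing in
  the unknown. In the scheme, \<open>\<kappa>\<close> is minus \<open>dt\<close> times the negative
  component of \<open>A *v y\<close>.\<close>

lemma add_powr_inj:
  fixes x y s \<kappa> r :: real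
  assumes "x > 0" "y > 0" "s > 0" "r > 0" "\<kappa> > 0"
    and "x + \<kappa> * (x / s) powr r = y + \<kappa> * (y / s) powr r"
  shows "x = y"
proof -
  have less: "u + \<kappa> * (u / s) powr r < v + \<kappa> * (v / s) powr r" if "0 < u" "u < v" for u v
  proof -
    have "(u / s) powr r \<le> (v / s) powr r"
      using that assms(3,4) by (intro powr_mono2 divide_right_mono) auto
    with that assms(5) show ?thesis
      by (intro add_less_le_mono mult_left_mono) auto
  qed
  show ?thesis
    using less[OF assms(1), of y] less[OF assms(2), of x] assms(6)
    by (metis less_irrefl linorder_neqE)
qed

lemma gBBKS1_map_steady_state:
  assumes "A *v y = 0" "y \<in> pos_orthant"
  shows "gBBKS1_map A dt \<sigma> r y = y"
  unfolding gBBKS1_map_def gBBKS1_step_def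
  by (rule the_equality) (auto simp: assms vec_eq_iff)

text \<open>With a single negative component \<open>m\<close> the product has one factor, so the
  equation for \<open>m\<close> is scalar and its root \<open>x\<close> determines all other
  components explicitly. Those do not decrease, hence stay positive; uniqueness comes from
  \<open>add_powr_inj\<close>.\<close>

lemma gBBKS1_map_eqI:
  assumes y: "y \<in> pos_orthant" and pos: "\<sigma> y $ m > 0" "r y > 0" "dt > 0" "x > 0"
    and m: "(A *v y) $ m < 0" "\<And>i. i \<noteq> m \<Longrightarrow> (A *v y) $ i \<ge> 0"
    and x: "x = y $ m + dt * (A *v y) $ m * (x / \<sigma> y $ m) powr r y"
  shows "gBBKS1_map A dt \<sigma> r y = y + (dt * (x / \<sigma> y $ m) powr r y) *\<^sub>R (A *v y)"
proof -
  have M: "{i. (A *v y) $ i < 0} = {m}"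
  proof -
    have "(A *v y) $ i < 0 \<longleftrightarrow> i = m" for i
      using m(1) m(2)[of i] by force
    then show ?thesis by simp
  qed
  have prod: "(\<Prod>i\<in>{m}. k i) = k m" for k :: "2 \<Rightarrow> real"
    by simp
  \<comment> \<open>Moves the power term to the left, where the negated coefficient is the positive
    \<open>\<kappa>\<close> of \<open>add_powr_inj\<close>.\<close>
  have shift: "t + - k * p = t' + - k * p'" if "t = v + k * p" "t' = v + k * p'" for t t' v k p p' :: real
    using that by simp
  define z where "z = y + (dt * (x / \<sigma> y $ m) powr r y) *\<^sub>R (A *v y)"
  have z_m: "z $ m = x"
    by (rule trans[OF _ x[symmetric]]) (simp add: z_def)
  show ?thesis
    unfolding gBBKS1_map_def gBBKS1_step_def z_def[symmetric] M prod
  proof (rule the_equality)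
    have "z $ i > 0" for i
    proof (cases "i = m")
      case True
      then show ?thesis using z_m pos by simp
    next
      case False
      then show ?thesis
        using m(2)[of i] y pos
        by (simp add: z_def pos_orthant_def add_pos_nonneg)
    qed
    then have "z \<in> pos_orthant"
      by (simp add: pos_orthant_def)
    moreover have "\<forall>i. z $ i = y $ i + dt * (A *v y) $ i * (z $ m / \<sigma> y $ m) powr r y"
      unfolding z_m by (simp add: z_def)
    ultimately show "z \<in> pos_orthant \<and>
        (\<forall>i. z $ i = y $ i + dt * (A *v y) $ i * (z $ m / \<sigma> y $ m) powr r y)" ..
  next
    fix u
    assume u: "u \<in> pos_orthant \<and>
        (\<forall>i. u $ i = y $ i + dt * (A *v y) $ i * (u $ m / \<sigma> y $ m) powr r y)"
    then have u_i: "u $ i = y $ i + dt * (A *v y) $ i * (u $ m / \<sigma> y $ m) powr r y" for i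
      by (elim conjE) (erule spec)
    have u_m: "u $ m > 0"
      using conjunct1[OF u] by (simp add: pos_orthant_def)
    have neg: "- (dt * (A *v y) $ m) > 0"
      using pos(3) m(1) by (simp add: mult_pos_neg)
    have u_m_eq: "u $ m = x"
      by (rule add_powr_inj[OF u_m pos(4,1,2) neg shift[OF u_i[of m] x]])
    have "u $ i = z $ i" for i
      using u_i[of i] by (simp only: u_m_eq) (simp add: z_def)
    then show "u = z"
      by (simp add: vec_eq_iff)
  qed
qed

section \<open>Branches of the map near the steady state\<close>

text \<open>The matrix has rank one. For \<open>c > 0\<close> the two components of the image have
  opposite signs, so off the kernel exactly one is negative.\<close>

lemma system_matrix_mult_vec:
  "system_matrix a b c *v y = (a * y $ 1 - b * y $ 2) *\<^sub>R vector [- c, 1]"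
  by (simp add: vec_eq_iff forall_2 system_matrix_def matrix_vector_mult_def sum_2 algebra_simps)

text \<open>In the product rule the derivative of \<open>\<phi>\<close> is multiplied by
  \<open>A *v y = 0\<close>, so only the value of \<open>\<phi>\<close> at \<open>y\<close> counts.
  Hence the two branches share their derivative on the kernel line.\<close>

lemma has_derivative_add_scaled_kernel:
  fixes A :: "real ^ 2 ^ 2"
  assumes "(\<phi> has_derivative \<phi>') (at y)" "\<phi> y = 1" "A *v y = 0"
  shows "((\<lambda>y. y + (dt * \<phi> y) *\<^sub>R (A *v y)) has_derivative (\<lambda>v. v + dt *\<^sub>R (A *v v))) (at y)"
proof -
  have "((\<lambda>y. y + (dt * \<phi> y) *\<^sub>R (A *v y)) has_derivative
      (\<lambda>v. v + ((dt * \<phi> y) *\<^sub>R (A *v v) + (dt * \<phi>' v) *\<^sub>R (A *v y)))) (at y)"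
    by (intro has_derivative_add has_derivative_ident has_derivative_scaleR has_derivative_mult_right
        assms(1) bounded_linear.has_derivative[OF matrix_vector_mul_bounded_linear])
  then show ?thesis
    using assms by simp
qed

lemma has_derivative_imp_jacobian:
  assumes "(f has_derivative f') (at x)"
  shows "jacobian f (at x) = matrix f'"
  unfolding jacobian_def using frechet_derivative_at[OF assms] by simp

lemma C11_at_gBBKS1_map:
  fixes ystar :: "real ^ 2"
  assumes "a > 0" and "b > 0" and "c > 0" and "dt > 0"
    and A: "A = system_matrix a b c"
    and ystar: "ystar \<in> pos_orthant" "A *v ystar = 0"
    and \<sigma>: "\<And>i. C11_at (\<lambda>y. \<sigma> y $ i) ystar"
           "\<And>y i. y \<in> pos_orthant \<Longrightarrow> \<sigma> y $ i > 0"
    and r: "C11_at r ystar" "\<And>y. y \<in> pos_orthant \<Longrightarrow> r y > 0"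
    and steady: "\<forall>\<^sub>F y in nhds ystar. A *v y = 0 \<longrightarrow> \<sigma> y = y"
  shows "C11_at (gBBKS1_map A dt \<sigma> r) ystar"
    and "(gBBKS1_map A dt \<sigma> r has_derivative (\<lambda>v. v + dt *\<^sub>R (A *v v))) (at ystar)"
proof -
  define g where "g = gBBKS1_map A dt \<sigma> r"
  define w where "w = (\<lambda>y::real^2. a * y $ 1 - b * y $ 2)"
  define P where "P = (\<lambda>\<phi> y. y + (dt * \<phi> y) *\<^sub>R (A *v y))"
  have Aw: "A *v y = w y *\<^sub>R vector [- c, 1]" for y
    by (simp add: A w_def system_matrix_mult_vec)
  have Aw_i: "(A *v y) $ 1 = - (c * w y)" "(A *v y) $ 2 = w y" for y
    by (simp_all add: Aw)
  have w: "bounded_linear w"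
    unfolding w_def by (intro bounded_linear_sub bounded_linear_const_mult bounded_linear_vec_nth)
  have ker: "A *v y = 0 \<longleftrightarrow> w y = 0" for y
    using Aw_i(2)[of y] by (metis Aw scaleR_zero_left zero_index)
  have wy: "w ystar = 0"
    using ystar(2) by (simp add: ker)
  have pos: "\<forall>\<^sub>F y in nhds ystar. y \<in> pos_orthant"
    by (rule eventually_nhds_in_open[OF open_pos_orthant ystar(1)])

  \<comment> \<open>Treats both half-planes at once: \<open>m\<close> is the component that
    decreases there and \<open>\<mu>\<close> its coefficient, \<open>- c\<close> for the first
    component and 1 for the second.\<close>
  have stage: "\<exists>\<phi>. C11_at (P \<phi>) ystar \<and>
      (\<forall>\<^sub>F y in nhds ystar. (A *v y) $ m < 0 \<or> w y = 0 \<longrightarrow> g y = P \<phi> y) \<and>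
      (\<forall>\<^sub>F y in nhds ystar. w y = 0 \<longrightarrow> (P \<phi> has_derivative (\<lambda>v. v + dt *\<^sub>R (A *v v))) (at y))"
    if m: "\<And>y. (A *v y) $ m = \<mu> * w y" "\<And>y i. (A *v y) $ m < 0 \<Longrightarrow> i \<noteq> m \<Longrightarrow> (A *v y) $ i \<ge> 0" for m \<mu>
  proof -
    have "ystar $ m > 0"
      using ystar by (simp add: pos_orthant_def)
    \<comment> \<open>This \<open>\<kappa>\<close> turns the implicit equation into component
      \<open>m\<close> of the scheme, because \<open>\<mu> * w y\<close> is that entry of
      \<open>A *v y\<close>.\<close>
    from implicit_powr_stage[OF w wy bounded_linear_vec_nth this \<sigma>(1)[of m] \<sigma>(2)[OF ystar(1)] r(1),
        where \<kappa> = "- dt * \<mu>"]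
    obtain h \<phi> where \<phi>: "C11_at \<phi> ystar" and ev: "\<forall>\<^sub>F y in nhds ystar. h y > 0 \<and>
      \<phi> y = (h y / \<sigma> y $ m) powr r y \<and> h y + - dt * \<mu> * w y * \<phi> y = y $ m" .
    have "C11_at (\<lambda>y. dt * (w y * \<phi> y)) ystar"
      by (intro C11_at_mult C11_at_const C11_at_bounded_linear[OF w] \<phi>)
    then have "C11_at (\<lambda>y. y + (dt * (w y * \<phi> y)) *\<^sub>R vector [- c, 1]) ystar"
      by (intro C11_at_add[OF C11_at_bounded_linear[OF bounded_linear_ident]]
          C11_at_bounded_linear_compose[OF bounded_linear_scaleR_left])
    then have "C11_at (P \<phi>) ystar"
      by (simp add: P_def Aw mult_ac)
    moreover have "\<forall>\<^sub>F y in nhds ystar. (A *v y) $ m < 0 \<or> w y = 0 \<longrightarrow> g y = P \<phi> y"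
      using ev pos
    proof eventually_elim
      case (elim y)
      show ?case
      proof (intro impI, elim disjE)
        assume neg: "(A *v y) $ m < 0"
        have \<phi>_y: "\<phi> y = (h y / \<sigma> y $ m) powr r y" and h_y: "h y > 0"
          and eq: "h y + - dt * \<mu> * w y * \<phi> y = y $ m"
          using elim(1) by blast+
        have "h y = y $ m + dt * (A *v y) $ m * \<phi> y"
          using eq by (simp add: m(1) algebra_simps)
        then have "h y = y $ m + dt * (A *v y) $ m * (h y / \<sigma> y $ m) powr r y"
          by (simp only: \<phi>_y)
        from gBBKS1_map_eqI[of y \<sigma> m r dt "h y" A,
            OF elim(2) \<sigma>(2)[OF elim(2)] r(2)[OF elim(2)] \<open>dt > 0\<close> h_y neg _ this]
        show "g y = P \<phi> y"
          unfolding g_def P_def \<phi>_y by this (rule m(2)[OF neg])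
      next
        \<comment> \<open>On the line both sides equal \<open>y\<close>.\<close>
        assume "w y = 0"
        then show "g y = P \<phi> y"
          using gBBKS1_map_steady_state[OF _ elim(2)] by (simp add: g_def P_def ker)
      qed
    qed
    \<comment> \<open>The derivative is identified along the whole line near \<open>ystar\<close>,
      because gluing compares the branches wherever a segment crosses it.\<close>
    moreover have "\<forall>\<^sub>F y in nhds ystar. w y = 0 \<longrightarrow> (P \<phi> has_derivative (\<lambda>v. v + dt *\<^sub>R (A *v v))) (at y)"
    proof -
      obtain \<phi>' where "\<forall>\<^sub>F y in nhds ystar. (\<phi> has_derivative blinfun_apply (\<phi>' y)) (at y)"
        using \<phi> by (rule C11_atE)
      with ev pos steady show ?thesis
      proof eventually_elim
        case (elim y)
        show ?case
        proof
          assume "w y = 0"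
          then have "A *v y = 0"
            by (simp only: ker)
          with elim(3) have "\<sigma> y = y"
            by (rule mp)
          moreover from elim(1) \<open>w y = 0\<close> have "h y = y $ m" "\<phi> y = (h y / \<sigma> y $ m) powr r y"
            by auto
          moreover from elim(2) have "y $ m > 0"
            by (simp add: pos_orthant_def)
          \<comment> \<open>Both \<open>h y\<close> and \<open>\<sigma> y $ m\<close> equal
            \<open>y $ m\<close>, so the base of the power is 1.\<close>
          ultimately have "\<phi> y = 1"
            by simp
          then show "(P \<phi> has_derivative (\<lambda>v. v + dt *\<^sub>R (A *v v))) (at y)"
            unfolding P_def by (rule has_derivative_add_scaled_kernel[OF elim(4) _ \<open>A *v y = 0\<close>])
        qed
      qed
    qed
    ultimately show ?thesis by blast
  qed

  have "(A *v y) $ i \<ge> 0" if "(A *v y) $ 1 < 0" "i \<noteq> 1" for y i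
  proof -
    have "i = 2" using exhaust_2[of i] that(2) by simp
    with that(1) show ?thesis using \<open>c > 0\<close> by (simp add: Aw_i zero_less_mult_iff)
  qed
  with stage[of 1 "- c"] obtain \<phi>1 where \<phi>1: "C11_at (P \<phi>1) ystar"
      "\<forall>\<^sub>F y in nhds ystar. (A *v y) $ 1 < 0 \<or> w y = 0 \<longrightarrow> g y = P \<phi>1 y"
      "\<forall>\<^sub>F y in nhds ystar. w y = 0 \<longrightarrow> (P \<phi>1 has_derivative (\<lambda>v. v + dt *\<^sub>R (A *v v))) (at y)"
    by (auto simp: Aw_i)
  have "(A *v y) $ i \<ge> 0" if "(A *v y) $ 2 < 0" "i \<noteq> 2" for y i
  proof -
    have "i = 1" using exhaust_2[of i] that(2) by simp
    with that(1) show ?thesis using \<open>c > 0\<close> by (simp add: Aw_i mult_le_0_iff)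
  qed
  with stage[of 2 1] obtain \<phi>2 where \<phi>2: "C11_at (P \<phi>2) ystar"
      "\<forall>\<^sub>F y in nhds ystar. (A *v y) $ 2 < 0 \<or> w y = 0 \<longrightarrow> g y = P \<phi>2 y"
      "\<forall>\<^sub>F y in nhds ystar. w y = 0 \<longrightarrow> (P \<phi>2 has_derivative (\<lambda>v. v + dt *\<^sub>R (A *v v))) (at y)"
    by (auto simp: Aw_i)
  have g1: "\<forall>\<^sub>F y in nhds ystar. w y \<ge> 0 \<longrightarrow> g y = P \<phi>1 y"
    using \<phi>1(2) by eventually_elim (use \<open>c > 0\<close> in \<open>simp add: Aw_i le_less\<close>)
  have g2: "\<forall>\<^sub>F y in nhds ystar. w y \<le> 0 \<longrightarrow> g y = P \<phi>2 y"
    using \<phi>2(2) by eventually_elim (simp add: Aw_i le_less)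
  have D: "\<forall>\<^sub>F y in nhds ystar. w y = 0 \<longrightarrow>
      (\<exists>D. (P \<phi>1 has_derivative D) (at y) \<and> (P \<phi>2 has_derivative D) (at y))"
    using \<phi>1(3) \<phi>2(3) by eventually_elim blast
  show "C11_at (gBBKS1_map A dt \<sigma> r) ystar"
    unfolding g_def[symmetric] by (rule C11_at_glue[OF w \<phi>1(1) g1 \<phi>2(1) g2 D])
  \<comment> \<open>\<open>C11_at\<close> does not name the derivative, so its value at
    \<open>ystar\<close> is read off from the two branches.\<close>
  show "(gBBKS1_map A dt \<sigma> r has_derivative (\<lambda>v. v + dt *\<^sub>R (A *v v))) (at ystar)"
    unfolding g_def[symmetric]
  proof (rule has_derivative_at_either[where ?f1.0 = "P \<phi>1" and ?f2.0 = "P \<phi>2"])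
    show "\<forall>\<^sub>F z in nhds ystar. g z = P \<phi>1 z \<or> g z = P \<phi>2 z"
      using g1 g2 by eventually_elim (auto simp: linorder_le_cases)
  qed (use eventually_nhds_x_imp_x[OF \<phi>1(3)] eventually_nhds_x_imp_x[OF \<phi>2(3)]
        eventually_nhds_x_imp_x[OF g1] eventually_nhds_x_imp_x[OF g2] wy in auto)
qed

section \<open>Assembly on a small neighbourhood\<close>

text \<open>Smallness of the neighbourhood is expressed by \<open>U\<close>, which depends on the
  data only and is fixed before \<open>D\<close>. Accordingly the proof splits on whether
  \<open>\<sigma>\<close> is the identity on the kernel near \<open>ystar\<close>, a property that
  does not mention \<open>D\<close>.\<close>

theorem theorem10:
  fixes a b c dt :: real
    and A :: "real ^ 2 ^ 2"
    and ystar :: "real ^ 2"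
    and \<sigma> :: "real ^ 2 \<Rightarrow> real ^ 2"
    and r :: "real ^ 2 \<Rightarrow> real"
    and g :: "real ^ 2 \<Rightarrow> real ^ 2"
  assumes "a > 0" and "b > 0" and "c > 0" and "dt > 0"
    and A: "A = system_matrix a b c"
    and ystar: "ystar \<in> pos_orthant" "A *v ystar = 0"
    and \<sigma>: "\<And>i. C2_on (\<lambda>y. \<sigma> y $ i) pos_orthant"
           "\<And>y i. y \<in> pos_orthant \<Longrightarrow> \<sigma> y $ i > 0"
    and r: "C2_on r pos_orthant"
           "\<And>y. y \<in> pos_orthant \<Longrightarrow> r y > 0"
    and g: "g = gBBKS1_map A dt \<sigma> r"
  shows "\<exists>U. open U \<and> ystar \<in> U \<and> U \<subseteq> pos_orthant \<and>
    (\<forall>D C. D \<subseteq> U \<longrightarrow> ystar \<in> interior D \<longrightarrow>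
       C = {v. A *v v = 0} \<inter> D \<longrightarrow> (\<forall>v\<in>C. \<sigma> v = v) \<longrightarrow>
         (\<forall>v\<in>C. g v = v) \<and>
         (C1_on g D \<and> jacobian g (at ystar) = mat 1 + dt *\<^sub>R A) \<and>
         (\<forall>i j. bounded ((\<lambda>x. jacobian g (at x) $ i $ j) ` D) \<and>
                (\<exists>L. L-lipschitz_on D (\<lambda>x. jacobian g (at x) $ i $ j))))"
proof (cases "\<forall>\<^sub>F y in nhds ystar. A *v y = 0 \<longrightarrow> \<sigma> y = y")
  case False
  \<comment> \<open>\<open>U\<close> is chosen before \<open>D\<close>; in this case no admissible \<open>D\<close> exists, whatever \<open>U\<close> is.\<close>
  have "\<not> (\<forall>v\<in>{v. A *v v = 0} \<inter> D. \<sigma> v = v)" if "ystar \<in> interior D" for D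
  proof
    assume id: "\<forall>v\<in>{v. A *v v = 0} \<inter> D. \<sigma> v = v"
    have "\<forall>\<^sub>F y in nhds ystar. y \<in> interior D"
      using that by (intro eventually_nhds_in_open) auto
    then have "\<forall>\<^sub>F y in nhds ystar. A *v y = 0 \<longrightarrow> \<sigma> y = y"
      by eventually_elim (use id interior_subset in blast)
    with False show False ..
  qed
  then show ?thesis
    using open_pos_orthant ystar(1) by (intro exI[of _ pos_orthant]) blast
next
  case True
  have "C11_at g ystar" and der: "(g has_derivative (\<lambda>v. v + dt *\<^sub>R (A *v v))) (at ystar)"
    unfolding g using assms(1-4) A ystar True r(2) \<sigma>(2)
      C2_on_imp_C11_at[OF \<sigma>(1) open_pos_orthant ystar(1)]
      C2_on_imp_C11_at[OF r(1) open_pos_orthant ystar(1)]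
    by (blast intro: C11_at_gBBKS1_map)+
  then obtain g' where g': "\<forall>\<^sub>F y in nhds ystar. (g has_derivative blinfun_apply (g' y)) (at y)"
      "lip_at g' ystar"
    by (blast elim: C11_atE)
  from g'(2) obtain d L where d: "d > 0" and L: "L-lipschitz_on (ball ystar d) g'"
    unfolding lip_at_def by blast
  from g'(2) obtain B where B: "\<forall>\<^sub>F y in nhds ystar. norm (g' y) \<le> B"
    by (rule lip_at_imp_bounded)
  have "\<forall>\<^sub>F y in nhds ystar. y \<in> ball ystar d \<inter> pos_orthant \<and>
      (g has_derivative blinfun_apply (g' y)) (at y) \<and> norm (g' y) \<le> B"
    using g'(1) B eventually_nhds_in_open[of "ball ystar d \<inter> pos_orthant" ystar]
      open_pos_orthant ystar(1) d
    by (auto simp: eventually_conj_iff)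
  \<comment> \<open>All estimates hold uniformly on \<open>U\<close>, so every subset
    \<open>D\<close> inherits them.\<close>
  then obtain U where U: "open U" "ystar \<in> U" "U \<subseteq> ball ystar d \<inter> pos_orthant"
    and der_g: "\<And>y. y \<in> U \<Longrightarrow> (g has_derivative blinfun_apply (g' y)) (at y)"
    and B: "\<And>y. y \<in> U \<Longrightarrow> norm (g' y) \<le> B"
    unfolding eventually_nhds by blast
  have jac: "jacobian g (at x) $ i $ j = g' x (axis j 1) $ i" if "x \<in> U" for x i j
    using has_derivative_imp_jacobian[OF der_g[OF that]] by (simp add: matrix_def)
  \<comment> \<open>\<open>axis j 1\<close> is a unit vector, so matrix entries are bounded by the
    operator norm; the claims on entries then follow from those on \<open>g'\<close>.\<close>
  have entry: "\<bar>T (axis j 1) $ i\<bar> \<le> norm T" for T :: "(real ^ 2) \<Rightarrow>\<^sub>L (real ^ 2)" and i j :: 2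
    using order_trans[OF component_le_norm_cart norm_blinfun[of T "axis j 1"]] by simp
  show ?thesis
  proof (rule exI[of _ U], intro conjI allI impI U(1,2))
    show "U \<subseteq> pos_orthant" using U(3) by blast
  next
    fix D C assume D: "D \<subseteq> U" and C: "C = {v. A *v v = 0} \<inter> D"
    have LD: "L-lipschitz_on D g'"
      using D U(3) by (intro lipschitz_on_subset[OF L]) blast
    show "\<forall>v\<in>C. g v = v"
      using C D U(3) by (auto simp: g intro!: gBBKS1_map_steady_state)
    show "C1_on g D"
      unfolding C1_on_def using D der_g lipschitz_on_continuous_on[OF LD] by blast
    have "matrix (\<lambda>v. v + dt *\<^sub>R (A *v v)) = mat 1 + dt *\<^sub>R A"
    proof -
      have "v + dt *\<^sub>R (A *v v) = (mat 1 + dt *\<^sub>R A) *v v" for v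
        by (simp add: matrix_vector_mult_add_rdistrib scaleR_matrix_vector_assoc)
      then show ?thesis by simp
    qed
    then show "jacobian g (at ystar) = mat 1 + dt *\<^sub>R A"
      using has_derivative_imp_jacobian[OF der] by simp
    fix i j
    show "bounded ((\<lambda>x. jacobian g (at x) $ i $ j) ` D)"
      unfolding bounded_iff
      using D by (intro exI[of _ B]) (force simp: jac intro: order_trans[OF entry B])
    show "\<exists>L. L-lipschitz_on D (\<lambda>x. jacobian g (at x) $ i $ j)"
    proof (intro exI lipschitz_onI)
      fix x y assume xy: "x \<in> D" "y \<in> D"
      then have "dist (jacobian g (at x) $ i $ j) (jacobian g (at y) $ i $ j)
          = \<bar>(g' x - g' y) (axis j 1) $ i\<bar>"
        using D by (simp add: jac subsetD dist_real_def blinfun.bilinear_simps)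
      also have "\<dots> \<le> norm (g' x - g' y)" by (rule entry)
      also have "\<dots> \<le> L * dist x y"
        using lipschitz_onD[OF LD xy] by (simp add: dist_norm)
      finally show "dist (jacobian g (at x) $ i $ j) (jacobian g (at y) $ i $ j) \<le> L * dist x y" .
    qed (rule lipschitz_on_nonneg[OF LD])
  qed
qed

end
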